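(* Let $n$ be a positive integer and let $G \leq \mathbf{U}(\mathbb{C}^n)$ be a finite subgroup of the group of complex unitary $(n\times n)$-matrices such that some orbit of $G$ on $\mathbb{C}^n$ spans $\mathbb{C}^n$ over $\mathbb{C}$ (that is, there is $v \in \mathbb{C}^n$ such that the $\mathbb{C}$-linear span of $Gv = \{Av : A \in G\}$ is $\mathbb{C}^n$). Then there is a subset $X \subseteq \mathbb{C}^n$, open and dense in the Euclidean topology, such that $G = \mathbf{U}(Gx)$ for all $x \in X$. In particular, $G$ is the setwise stabilizer in $\mathbf{U}(\mathbb{C}^n)$ of one of its orbits.
   Context: $\mathbf{U}(\mathbb{C}^n)$ denotes the group of all complex unitary $(n\times n)$-matrices, acting on $\mathbb{C}^n$ by matrix-vector multiplication. For a subset $Y \subseteq \mathbb{C}^n$, $\mathbf{U}(Y) = \{A \in \mathbf{U}(\mathbb{C}^n) : AY = Y\}$ denotes the setwise stabilizer of $Y$ in $\mathbf{U}(\mathbb{C}^n)$, where $AY = \{Ay : y \in Y\}$. For $x \in \mathbb{C}^n$, $Gx = \{Ax : A \in G\}$ is the orbit of $x$ under $G$. *)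

theory Defs
  imports "HOL-Analysis.Analysis" "HOL-Algebra.Group"
begin

definition conj_transpose :: "complex^'n^'m \<Rightarrow> complex^'m^'n" where
  "conj_transpose A = (\<chi> i j. cnj (A $ j $ i))"

definition unitary_matrix :: "complex^'n^'n \<Rightarrow> bool" where
  "unitary_matrix A \<longleftrightarrow> conj_transpose A ** A = mat 1 \<and> A ** conj_transpose A = mat 1"

definition unitary_group :: "(complex^'n^'n) monoid" where
  "unitary_group = \<lparr>carrier = {A. unitary_matrix A}, monoid.mult = (**), one = mat 1\<rparr>"

definition matrix_orbit :: "(complex^'n^'n) set \<Rightarrow> complex^'n \<Rightarrow> (complex^'n) set" where
  "matrix_orbit G x = (\<lambda>A. A *v x) ` G"

definition unitary_stabilizer :: "(complex^'n) set \<Rightarrow> (complex^'n^'n) set" where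
  "unitary_stabilizer Y = {A \<in> carrier unitary_group. (\<lambda>y. A *v y) ` Y = Y}"

lemma conj_transpose_mult: "conj_transpose (A ** B) = conj_transpose B ** conj_transpose A"
  by (simp add: conj_transpose_def matrix_matrix_mult_def vec_eq_iff mult.commute)

lemma conj_transpose_conj_transpose [simp]: "conj_transpose (conj_transpose A) = A"
  by (simp add: conj_transpose_def vec_eq_iff)

lemma conj_transpose_mat_1 [simp]: "conj_transpose (mat 1) = mat 1"
  by (simp add: conj_transpose_def mat_def vec_eq_iff)

lemma unitary_matrix_mult:
  assumes "unitary_matrix A" "unitary_matrix B"
  shows "unitary_matrix (A ** B)"
proof -
  have "conj_transpose B ** conj_transpose A ** (A ** B)
      = conj_transpose B ** (conj_transpose A ** A) ** B"
    by (simp add: matrix_mul_assoc)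
  moreover have "A ** B ** (conj_transpose B ** conj_transpose A)
      = A ** (B ** conj_transpose B) ** conj_transpose A"
    by (simp add: matrix_mul_assoc)
  ultimately show ?thesis
    using assms by (simp add: unitary_matrix_def conj_transpose_mult)
qed

lemma group_unitary_group: "group (unitary_group :: (complex^'n^'n) monoid)"
proof (rule groupI)
  fix A :: "complex^'n^'n"
  assume "A \<in> carrier unitary_group"
  then show "\<exists>B\<in>carrier unitary_group. B \<otimes>\<^bsub>unitary_group\<^esub> A = \<one>\<^bsub>unitary_group\<^esub>"
    by (intro bexI[of _ "conj_transpose A"])
      (simp_all add: unitary_group_def unitary_matrix_def)
qed (simp_all add: unitary_group_def unitary_matrix_mult matrix_mul_assoc,
     simp add: unitary_matrix_def)

end

theory Submission
  imports Defs "HOL-Computational_Algebra.Polynomial"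
begin

text \<open>
  For generic \<open>x\<close> the values \<open>\<langle>g x, x\<rangle>\<close>, \<open>g \<in> G\<close>, are pairwise distinct, since a matrix \<open>M\<close> with
  \<open>\<langle>M x, x\<rangle> = 0\<close> for all \<open>x\<close> vanishes over the complex numbers; moreover \<open>G x\<close> spans.
  Let \<open>A\<close> be unitary with \<open>A (G x) = G x\<close>. After multiplication by an element of \<open>G\<close> we
  may assume \<open>A x = x\<close>. If \<open>A g x = h x\<close>, then \<open>\<langle>h x, x\<rangle> = \<langle>A g x, A x\<rangle> = \<langle>g x, x\<rangle>\<close>, so \<open>h = g\<close>.
  Hence \<open>A\<close> fixes the spanning set \<open>G x\<close> pointwise and is the identity.
\<close>

subsection \<open>Density of non-vanishing loci\<close>

text \<open>A stand-in for real polynomial maps that avoids multivariate polynomials. The lines are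
  real because Hermitian expressions involve \<open>cnj\<close>, which is only real linear; one
  variable suffices for density, as a nonzero polynomial has finitely many roots.\<close>

definition poly_on_lines :: "('a::real_normed_vector \<Rightarrow> complex) \<Rightarrow> bool" where
  "poly_on_lines f \<longleftrightarrow> continuous_on UNIV f \<and>
     (\<forall>x u. \<exists>p. \<forall>t::real. f (x + t *\<^sub>R u) = poly p (of_real t))"

lemma poly_on_lines_bounded_linear:
  assumes "bounded_linear f"
  shows "poly_on_lines f"
  unfolding poly_on_lines_def
proof (intro conjI allI)
  interpret bounded_linear f by fact
  show "continuous_on UNIV f"
    by (rule linear_continuous_on) fact
  show "\<exists>p. \<forall>t::real. f (x + t *\<^sub>R u) = poly p (of_real t)" for x u
    by (rule exI[of _ "[:f x, f u:]"]) (simp add: add scaleR scaleR_conv_of_real)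
qed

lemma poly_on_lines_const: "poly_on_lines (\<lambda>_. c)"
  unfolding poly_on_lines_def by (intro conjI allI exI[of _ "[:c:]"]) simp_all

lemma poly_on_lines_add:
  assumes "poly_on_lines f" "poly_on_lines g"
  shows "poly_on_lines (\<lambda>x. f x + g x)"
  unfolding poly_on_lines_def
proof (intro conjI allI)
  show "continuous_on UNIV (\<lambda>x. f x + g x)"
    using assms by (auto simp: poly_on_lines_def intro: continuous_on_add)
  fix x u
  obtain p q where "\<And>t::real. f (x + t *\<^sub>R u) = poly p (of_real t)"
    "\<And>t::real. g (x + t *\<^sub>R u) = poly q (of_real t)"
    using assms unfolding poly_on_lines_def by meson
  then show "\<exists>p. \<forall>t::real. f (x + t *\<^sub>R u) + g (x + t *\<^sub>R u) = poly p (of_real t)"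
    by (intro exI[of _ "p + q"]) simp
qed

lemma poly_on_lines_mult:
  assumes "poly_on_lines f" "poly_on_lines g"
  shows "poly_on_lines (\<lambda>x. f x * g x)"
  unfolding poly_on_lines_def
proof (intro conjI allI)
  show "continuous_on UNIV (\<lambda>x. f x * g x)"
    using assms by (auto simp: poly_on_lines_def intro: continuous_on_mult)
  fix x u
  obtain p q where "\<And>t::real. f (x + t *\<^sub>R u) = poly p (of_real t)"
    "\<And>t::real. g (x + t *\<^sub>R u) = poly q (of_real t)"
    using assms unfolding poly_on_lines_def by meson
  then show "\<exists>p. \<forall>t::real. f (x + t *\<^sub>R u) * g (x + t *\<^sub>R u) = poly p (of_real t)"
    by (intro exI[of _ "p * q"]) simp
qed

lemma poly_on_lines_sum:
  assumes "\<And>i. i \<in> I \<Longrightarrow> poly_on_lines (f i)"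
  shows "poly_on_lines (\<lambda>x. \<Sum>i\<in>I. f i x)"
  using assms
  \<comment> \<open>For infinite \<open>I\<close> the sum is 0 by convention, hence
    constant.\<close>
  by (induction I rule: infinite_finite_induct)
    (simp_all add: poly_on_lines_const poly_on_lines_add)

lemma poly_on_lines_prod:
  assumes "\<And>i. i \<in> I \<Longrightarrow> poly_on_lines (f i)"
  shows "poly_on_lines (\<lambda>x. \<Prod>i\<in>I. f i x)"
  using assms
  by (induction I rule: infinite_finite_induct)
    (simp_all add: poly_on_lines_const poly_on_lines_mult)

lemma poly_on_lines_det:
  fixes M :: "'a::real_normed_vector \<Rightarrow> complex^'n^'n"
  assumes "\<And>i j. poly_on_lines (\<lambda>x. M x $ i $ j)"
  shows "poly_on_lines (\<lambda>x. det (M x))"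
  unfolding det_def
  by (intro poly_on_lines_sum poly_on_lines_mult poly_on_lines_const poly_on_lines_prod assms)

text \<open>Density: on the line from \<open>x\<close> (at \<open>t = 0\<close>) to \<open>u\<close>
  (at \<open>t = 1\<close>) the polynomial is nonzero, having value \<open>f u\<close> at 1. Its
  roots are finite in number, so points with small nonzero \<open>t\<close> avoid the zero locus and
  tend to \<open>x\<close>.\<close>

lemma poly_on_lines_open_dense:
  assumes f: "poly_on_lines f" and u: "f u \<noteq> 0"
  shows "open {x. f x \<noteq> 0}" "closure {x. f x \<noteq> 0} = UNIV"
proof -
  have "open (f -` (- {0}))"
    using f by (intro open_vimage) (auto simp: poly_on_lines_def)
  then show "open {x. f x \<noteq> 0}"
    by (simp add: vimage_def)
  have "x \<in> closure {x. f x \<noteq> 0}" for x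
  proof -
    obtain p where p: "\<And>t::real. f (x + t *\<^sub>R (u - x)) = poly p (of_real t)"
      using f unfolding poly_on_lines_def by meson
    have "p \<noteq> 0"
      using p[of 1] u by auto
    then have "finite {z. poly p z = 0}"
      by (rule poly_roots_finite)
    then have "finite (of_real -` {z. poly p z = 0} :: real set)"
      by (rule finite_vimageI) (simp add: inj_def)
    then have "eventually (\<lambda>t::real. t \<notin> of_real -` {z. poly p z = 0}) (at 0)"
      by (metis islimpt_finite islimpt_iff_eventually)
    then have ev: "eventually (\<lambda>t::real. x + t *\<^sub>R (u - x) \<in> {x. f x \<noteq> 0}) (at 0)"
      by eventually_elim (simp add: p)
    have "((\<lambda>t::real. x + t *\<^sub>R (u - x)) \<longlongrightarrow> x + 0 *\<^sub>R (u - x)) (at 0)"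
      by (intro tendsto_intros)
    then show ?thesis
      using Lim_in_closed_set[OF closed_closure] ev closure_subset
      by (smt (verit) eventually_mono scaleR_zero_left add_0_right subsetD trivial_limit_at)
  qed
  then show "closure {x. f x \<noteq> 0} = UNIV"
    by auto
qed

lemma open_dense_Int:
  assumes "open S" "closure S = UNIV" "closure T = UNIV"
  shows "closure (S \<inter> T) = UNIV"
  using open_Int_closure_subset[OF assms(1), of T] assms(2,3)
  by (metis closure_closure closure_mono inf_top_right top.extremum_unique)

lemma open_dense_INT:
  assumes "finite I" "\<And>i. i \<in> I \<Longrightarrow> open (S i)" "\<And>i. i \<in> I \<Longrightarrow> closure (S i) = UNIV"
  shows "closure (\<Inter>i\<in>I. S i) = UNIV"
  using assms by (induction I rule: finite_induct) (simp_all add: open_dense_Int)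

subsection \<open>The standard Hermitian form\<close>

definition herm :: "complex^'n \<Rightarrow> complex^'n \<Rightarrow> complex" where
  "herm x y = (\<Sum>i\<in>UNIV. x $ i * cnj (y $ i))"

lemma herm_add_left: "herm (x + y) z = herm x z + herm y z"
  and herm_add_right: "herm x (y + z) = herm x y + herm x z"
  and herm_diff_left: "herm (x - y) z = herm x z - herm y z"
  and herm_scale_left: "herm (c *s x) y = c * herm x y"
  and herm_scale_right: "herm x (c *s y) = cnj c * herm x y"
  by (simp_all add: herm_def algebra_simps sum.distrib sum_subtractf sum_distrib_left)

lemma herm_axis: "herm x (axis i 1) = x $ i"
proof -
  have "herm x (axis i 1) = (\<Sum>j\<in>UNIV. if j = i then x $ j else 0)"
    unfolding herm_def by (rule sum.cong) (auto simp: axis_def)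
  then show ?thesis
    by simp
qed

lemma herm_conj_transpose: "herm (A *v x) y = herm x (conj_transpose A *v y)"
proof -
  have "herm (A *v x) y = (\<Sum>i\<in>UNIV. \<Sum>j\<in>UNIV. A $ i $ j * x $ j * cnj (y $ i))"
    by (simp add: herm_def matrix_vector_mult_def sum_distrib_right)
  also have "\<dots> = (\<Sum>j\<in>UNIV. \<Sum>i\<in>UNIV. A $ i $ j * x $ j * cnj (y $ i))"
    by (rule sum.swap)
  also have "\<dots> = herm x (conj_transpose A *v y)"
    by (simp add: herm_def matrix_vector_mult_def conj_transpose_def sum_distrib_left mult_ac)
  finally show ?thesis .
qed

lemma herm_unitary:
  assumes "unitary_matrix A"
  shows "herm (A *v x) (A *v y) = herm x y"
  using assms by (simp add: herm_conj_transpose matrix_vector_mul_assoc unitary_matrix_def)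

text \<open>Polarization. The complex scalars are essential: a real skew-symmetric matrix has zero
  quadratic form on real vectors.\<close>

lemma quadratic_form_eq_0_imp_matrix_eq_0:
  fixes M :: "complex^'n^'n"
  assumes "\<And>x. herm (M *v x) x = 0"
  shows "M = 0"
proof -
  have *: "herm (M *v x) y + herm (M *v y) x = 0" for x y
    using assms[of "x + y"] assms[of x] assms[of y]
    by (simp add: matrix_vector_right_distrib herm_add_left herm_add_right add.commute)
  \<comment> \<open>Put \<open>a = herm (M *v x) y\<close> and \<open>b = herm (M *v y) x\<close>.
    The pair \<open>x\<close>, \<open>y\<close> gives \<open>a + b = 0\<close>; replacing
    \<open>y\<close> by \<open>\<i> *s y\<close> gives \<open>b - a = 0\<close> after cancelling
    \<open>\<i>\<close>.\<close>
  have **: "herm (M *v x) y = 0" for x y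
    using *[of x y] *[of x "\<i> *s y"]
    by (simp add: vector_scalar_commute herm_scale_left herm_scale_right)
  have "M *v x = 0" for x
    using **[of x "axis i 1" for i] by (simp add: herm_axis vec_eq_iff)
  then show ?thesis
    by (metis matrix_eq matrix_vector_mult_0)
qed

lemma poly_on_lines_matrix_vector_nth: "poly_on_lines (\<lambda>x::complex^'n. (M *v x) $ i)"
  by (rule poly_on_lines_bounded_linear)
    (intro bounded_linear_compose[OF bounded_linear_vec_nth] matrix_vector_mul_bounded_linear)

lemma poly_on_lines_quadratic_form: "poly_on_lines (\<lambda>x. herm (M *v x) x)"
  unfolding herm_def
  by (intro poly_on_lines_sum poly_on_lines_mult poly_on_lines_matrix_vector_nth
      poly_on_lines_bounded_linear bounded_linear_compose[OF bounded_linear_cnj]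
      bounded_linear_vec_nth)

subsection \<open>Generic orbits\<close>

lemma mat_matrix_vector_mult: "mat c *v x = c *s (x :: 'a::semiring_1^'n)"
proof -
  have "(mat c *v x) $ i = (\<Sum>j\<in>UNIV. if i = j then c * x $ j else 0)" for i
    unfolding matrix_vector_mult_def mat_def vec_lambda_beta by (rule sum.cong) auto
  then show ?thesis
    by (simp add: vec_eq_iff)
qed

text \<open>Write each standard basis vector as a combination of the orbit of \<open>v\<close>, then
  keep the coefficients and let \<open>v\<close> vary. The resulting vectors stay in the span of the
  moving orbit and form a basis wherever a determinant, equal to 1 at \<open>v\<close>, does not
  vanish.\<close>

lemma spanning_orbit_open_dense:
  fixes G :: "(complex^'n^'n) set"
  assumes "vec.span (matrix_orbit G v) = UNIV"
  obtains S where "open S" "closure S = UNIV"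
    "\<And>x. x \<in> S \<Longrightarrow> vec.span (matrix_orbit G x) = UNIV"
proof -
  \<comment> \<open>\<open>?P\<close> captures what is needed of linear combinations of elements of
    \<open>G\<close>, so that \<open>T\<close> can be built by induction over the span without
    naming coefficients.\<close>
  let ?P = "\<lambda>T. \<forall>x. T *v x \<in> vec.span (matrix_orbit G x)"
  have "\<exists>T. T *v v = y \<and> ?P T" if "y \<in> vec.span (matrix_orbit G v)" for y
    using that
  proof (induction rule: vec.span_induct_alt)
    case base
    show ?case
      by (rule exI[of _ 0]) (simp add: vec.span_zero)
  next
    case (step c y z)
    then obtain A T where "A \<in> G" "y = A *v v" "T *v v = z" "?P T"
      by (auto simp: matrix_orbit_def)
    moreover have "(mat c ** A + T) *v x = c *s (A *v x) + T *v x" for x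
      by (simp add: matrix_vector_mult_add_rdistrib mat_matrix_vector_mult
          flip: matrix_vector_mul_assoc)
    moreover have "A *v x \<in> matrix_orbit G x" for x
      using \<open>A \<in> G\<close> by (simp add: matrix_orbit_def)
    ultimately show ?case
      by (intro exI[of _ "mat c ** A + T"])
        (simp add: vec.span_add vec.span_scale vec.span_base)
  qed
  then have "\<forall>j. \<exists>T. T *v v = axis j 1 \<and> ?P T"
    using assms by blast
  then obtain T where T: "\<And>j::'n. T j *v v = axis j 1" "\<And>j. ?P (T j)"
    by metis
  \<comment> \<open>The columns of \<open>M x\<close> are the vectors \<open>T j *v x\<close>; at
    \<open>v\<close> they are the standard basis.\<close>
  define M where "M = (\<lambda>x. \<chi> i j. (T j *v x) $ i)"
  have poly: "poly_on_lines (\<lambda>x. det (M x))"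
    by (intro poly_on_lines_det) (simp add: M_def poly_on_lines_matrix_vector_nth)
  have "M v = mat 1"
    by (simp add: M_def T vec_eq_iff mat_def axis_def)
  then have nz: "det (M v) \<noteq> 0"
    by simp
  show thesis
  proof (rule that[OF poly_on_lines_open_dense[OF poly nz]])
    fix x
    assume "x \<in> {x. det (M x) \<noteq> 0}"
    then have "vec.span (columns (M x)) = UNIV"
      by (metis mem_Collect_eq invertible_det_nz invertible_right_inverse
          matrix_right_invertible_span_columns)
    moreover have "columns (M x) \<subseteq> vec.span (matrix_orbit G x)"
      using T(2) by (auto simp: columns_def column_def M_def)
    ultimately show "vec.span (matrix_orbit G x) = UNIV"
      by (metis vec.span_mono vec.span_span top.extremum_unique)
  qed
qed

section \<open>Stabilizers of orbits\<close>

lemma matrix_eq_on_span: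
  fixes A B :: "'a::field^'n^'m"
  assumes "\<And>x. x \<in> S \<Longrightarrow> A *v x = B *v x" "vec.span S = UNIV"
  shows "A = B"
proof -
  have "A *v x = B *v x" if "x \<in> vec.span S" for x
    using that
    by (induction rule: vec.span_induct_alt)
      (simp_all add: assms(1) matrix_vector_right_distrib vector_scalar_commute)
  with assms(2) show ?thesis
    by (simp add: matrix_eq)
qed

lemma subgroup_subset_unitary_stabilizer:
  assumes "subgroup G unitary_group"
  shows "G \<subseteq> unitary_stabilizer (matrix_orbit G x)"
proof
  interpret subgroup G unitary_group by fact
  interpret U: group unitary_group by (rule group_unitary_group)
  fix A
  assume A: "A \<in> G"
  have "A *v (B *v x) \<in> matrix_orbit G x" if "B \<in> G" for B
    using m_closed[OF A that]
    by (auto simp: matrix_orbit_def unitary_group_def matrix_vector_mul_assoc)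
  \<comment> \<open>Surjectivity on the orbit: \<open>B *v x\<close> is the image under
    \<open>A\<close> of the orbit point given by the inverse of \<open>A\<close> times
    \<open>B\<close>.\<close>
  moreover have "B *v x \<in> (\<lambda>y. A *v y) ` matrix_orbit G x" if "B \<in> G" for B
  proof -
    let ?C = "inv\<^bsub>unitary_group\<^esub> A"
    have "A ** ?C = mat 1"
      using U.r_inv[OF mem_carrier[OF A]] by (simp add: unitary_group_def)
    then have "B *v x = A *v ((?C ** B) *v x)"
      by (simp add: matrix_vector_mul_assoc matrix_mul_assoc)
    moreover have "?C ** B \<in> G"
      using m_closed[OF m_inv_closed[OF A] that] by (simp add: unitary_group_def)
    ultimately show ?thesis
      unfolding matrix_orbit_def by blast
  qed
  ultimately show "A \<in> unitary_stabilizer (matrix_orbit G x)"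
    using mem_carrier[OF A] by (auto simp: unitary_stabilizer_def matrix_orbit_def)
qed

lemma unitary_stabilizer_subset_subgroup:
  fixes G :: "(complex^'n^'n) set"
  assumes G: "subgroup G unitary_group"
    and span: "vec.span (matrix_orbit G x) = UNIV"
    and inj: "inj_on (\<lambda>A. herm (A *v x) x) G"
  shows "unitary_stabilizer (matrix_orbit G x) \<subseteq> G"
proof
  interpret subgroup G unitary_group by fact
  interpret U: group unitary_group by (rule group_unitary_group)
  fix A
  assume "A \<in> unitary_stabilizer (matrix_orbit G x)"
  then have A: "unitary_matrix A" "(\<lambda>y. A *v y) ` matrix_orbit G x = matrix_orbit G x"
    by (simp_all add: unitary_stabilizer_def unitary_group_def)
  have perm: "\<exists>C\<in>G. A *v (B *v x) = C *v x" if "B \<in> G" for B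
    using A(2) that by (auto simp: matrix_orbit_def)
  have "mat 1 \<in> G"
    using one_closed by (simp add: unitary_group_def)
  from perm[OF this] obtain K where K: "K \<in> G" "A *v x = K *v x"
    by auto
  \<comment> \<open>\<open>L ** A\<close> fixes \<open>x\<close>, still permutes the orbit, and lies
    in \<open>G\<close> exactly when \<open>A\<close> does.\<close>
  define L where "L = inv\<^bsub>unitary_group\<^esub> K"
  have L: "L \<in> G" "L ** K = mat 1" "K ** L = mat 1"
    using m_inv_closed[OF K(1)] U.l_inv[OF mem_carrier[OF K(1)]] U.r_inv[OF mem_carrier[OF K(1)]]
    by (simp_all add: L_def unitary_group_def)
  have "unitary_matrix (L ** A)"
    using A(1) mem_carrier[OF L(1)] by (simp add: unitary_group_def unitary_matrix_mult)
  moreover have Lx: "(L ** A) *v x = x"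
    using K(2) L(2) by (metis matrix_vector_mul_assoc matrix_vector_mul_lid)
  moreover have "(L ** A) *v (B *v x) = B *v x" if "B \<in> G" for B
  proof -
    obtain C where C: "C \<in> G" "A *v (B *v x) = C *v x"
      using perm[OF \<open>B \<in> G\<close>] by blast
    have LC: "L ** C \<in> G"
      using m_closed[OF L(1) C(1)] by (simp add: unitary_group_def)
    have eq: "(L ** A) *v (B *v x) = (L ** C) *v x"
      using C(2) by (simp flip: matrix_vector_mul_assoc)
    \<comment> \<open>Since \<open>L ** A\<close> fixes \<open>x\<close>, it may be inserted in the
      second argument too, and unitarity then removes it from both. Injectivity on \<open>G\<close>
      yields equality of matrices, not only of orbit points.\<close>
    have "herm ((L ** C) *v x) x = herm ((L ** A) *v (B *v x)) ((L ** A) *v x)"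
      by (simp only: eq Lx)
    also have "\<dots> = herm (B *v x) x"
      by (rule herm_unitary) fact
    finally have "L ** C = B"
      using inj LC that by (auto dest: inj_onD)
    then show ?thesis
      using eq by simp
  qed
  ultimately have "L ** A = mat 1"
    by (intro matrix_eq_on_span[OF _ span]) (auto simp: matrix_orbit_def)
  then have "A = K"
    using L(3) by (metis matrix_mul_assoc matrix_mul_lid matrix_mul_rid)
  with K show "A \<in> G"
    by simp
qed

theorem theorem1:
  fixes G :: "(complex^'n^'n) set"
  assumes "subgroup G unitary_group"
    and "finite G"
    and "\<exists>v :: complex^'n. vec.span (matrix_orbit G v) = UNIV"
  shows "(\<exists>X :: (complex^'n) set. open X \<and> closure X = UNIV \<and>
            (\<forall>x\<in>X. G = unitary_stabilizer (matrix_orbit G x))) \<and>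
         (\<exists>x :: complex^'n. G = unitary_stabilizer (matrix_orbit G x))"
proof -
  obtain S where S: "open S" "closure S = UNIV"
    "\<And>x. x \<in> S \<Longrightarrow> vec.span (matrix_orbit G x) = UNIV"
    using assms(3) spanning_orbit_open_dense by blast
  \<comment> \<open>Each pair in \<open>I\<close> contributes one open dense condition, separating
    the values of the form at \<open>A\<close> and \<open>B\<close>. Finiteness of \<open>G\<close>
    keeps the intersection open and dense; for trivial \<open>G\<close> it is the whole
    space.\<close>
  define I where "I = {(A, B) \<in> G \<times> G. A \<noteq> B}"
  define U where "U = (\<lambda>(A, B). {x :: complex^'n. herm ((A - B) *v x) x \<noteq> 0})"
  have "finite I"
    unfolding I_def by (rule finite_subset[of _ "G \<times> G"]) (use assms(2) in auto)
  have U: "open (U i)" "closure (U i) = UNIV" if "i \<in> I" for i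
  proof -
    obtain A B where i: "i = (A, B)" "A - B \<noteq> 0"
      using \<open>i \<in> I\<close> by (auto simp: I_def)
    then obtain u where "herm ((A - B) *v u) u \<noteq> 0"
      using quadratic_form_eq_0_imp_matrix_eq_0 by blast
    from poly_on_lines_open_dense[OF poly_on_lines_quadratic_form this]
    show "open (U i)" "closure (U i) = UNIV"
      by (simp_all add: U_def i)
  qed
  define X where "X = S \<inter> (\<Inter>i\<in>I. U i)"
  have "open X"
    unfolding X_def using S(1) U(1) \<open>finite I\<close> by (blast intro: open_INT)
  moreover have dense: "closure X = UNIV"
    unfolding X_def by (intro open_dense_Int open_dense_INT S U \<open>finite I\<close>)
  moreover have stab: "G = unitary_stabilizer (matrix_orbit G x)" if "x \<in> X" for x
  proof
    have "inj_on (\<lambda>A. herm (A *v x) x) G"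
    proof (rule inj_onI, rule ccontr)
      fix A B
      assume "A \<in> G" "B \<in> G" "herm (A *v x) x = herm (B *v x) x" "A \<noteq> B"
      then show False
        using that by (auto simp: X_def I_def U_def matrix_vector_mult_diff_rdistrib herm_diff_left)
    qed
    then show "unitary_stabilizer (matrix_orbit G x) \<subseteq> G"
      using that assms(1) S(3) by (intro unitary_stabilizer_subset_subgroup) (auto simp: X_def)
  qed (rule subgroup_subset_unitary_stabilizer[OF assms(1)])
  \<comment> \<open>Any point of \<open>X\<close> provides the single orbit required by the second
    claim.\<close>
  moreover have "X \<noteq> {}"
    using dense by auto
  ultimately show ?thesis
    by blast
qed

end
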